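(* Let $q\equiv 1\pmod 4$ be a prime power. Then the Paley graph $P(q)$ is distance transitive (for all such $q$), but $P(q)$ is geodesic transitive if and only if $q=5$ or $q=9$.
   Context: For a prime power $q\equiv 1\pmod 4$, the Paley graph $P(q)$ has vertex set the finite field $\mathbb{F}_q$, two distinct vertices $u,v$ being adjacent if and only if $u-v$ is a nonzero square in $\mathbb{F}_q$ (this is a symmetric relation because $-1$ is a square). A connected graph $\Gamma$ is distance transitive if for any two pairs of vertices $(u_1,v_1)$, $(u_2,v_2)$ with the same distance there is $g\in\mathrm{Aut}(\Gamma)$ with $u_1^g=u_2$, $v_1^g=v_2$. An $i$-geodesic is a path $(v_0,\dots,v_i)$ such that the distance from $v_0$ to $v_i$ is $i$. A connected graph $\Gamma$ of diameter $d$ is geodesic transitive if for each $i=1,\dots,d$ the group $\mathrm{Aut}(\Gamma)$ is transitive on the set of $i$-geodesics. *)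

theory Defs
  imports
    "Graph_Theory.Graph_Theory"
    "HOL-Number_Theory.Number_Theory"
    "HOL-Computational_Algebra.Computational_Algebra"
    "HOL-Library.Cardinality"
begin

text \<open>Undirected graphs are symmetric digraphs, as in \<^locale>\<open>graph\<close>.  The name \<open>connected\<close> is
  qualified below because it is also used for topological spaces.\<close>

definition graph_dist :: "('a, 'b) pre_digraph \<Rightarrow> 'a \<Rightarrow> 'a \<Rightarrow> ereal" where
  "graph_dist G u v = wf_digraph.\<mu> G (\<lambda>_. 1) u v"

definition graph_diameter :: "('a, 'b) pre_digraph \<Rightarrow> ereal" where
  "graph_diameter G = (SUP u \<in> verts G. SUP v \<in> verts G. graph_dist G u v)"

definition graph_automorphisms ::
    "('a, 'b) pre_digraph \<Rightarrow> ('a, 'b, 'a, 'b) digraph_isomorphism set" where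
  "graph_automorphisms G = {f. pre_digraph.digraph_isomorphism G f \<and> app_iso f G = G}"

definition distance_transitive :: "('a, 'b) pre_digraph \<Rightarrow> bool" where
  "distance_transitive G \<longleftrightarrow> Digraph_Component.connected G \<and>
    (\<forall>u1 \<in> verts G. \<forall>v1 \<in> verts G. \<forall>u2 \<in> verts G. \<forall>v2 \<in> verts G.
      graph_dist G u1 v1 = graph_dist G u2 v2 \<longrightarrow>
      (\<exists>f \<in> graph_automorphisms G. iso_verts f u1 = u2 \<and> iso_verts f v1 = v2))"

text \<open>A geodesic is given by its list of vertices \<open>[v\<^sub>0, \<dots>, v\<^sub>i]\<close>.\<close>

definition geodesic :: "('a, 'b) pre_digraph \<Rightarrow> nat \<Rightarrow> 'a list \<Rightarrow> bool" where
  "geodesic G i p \<longleftrightarrow>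
    vpath p G \<and> vwalk_length p = i \<and> graph_dist G (hd p) (last p) = ereal (real i)"

definition geodesic_transitive :: "('a, 'b) pre_digraph \<Rightarrow> bool" where
  "geodesic_transitive G \<longleftrightarrow> Digraph_Component.connected G \<and>
    (\<forall>i::nat. 1 \<le> i \<and> ereal (real i) \<le> graph_diameter G \<longrightarrow>
      (\<forall>p p'. geodesic G i p \<and> geodesic G i p' \<longrightarrow>
        (\<exists>f \<in> graph_automorphisms G. map (iso_verts f) p = p')))"

text \<open>The graph \<open>P(q)\<close> is the instance where \<^typ>\<open>'a\<close> is a finite field with \<open>q\<close> elements.\<close>

definition paley_graph :: "('a::field, 'a \<times> 'a) pre_digraph" where
  "paley_graph = with_proj
    \<lparr> pverts = UNIV, parcs = {(u, v). u \<noteq> v \<and> (\<exists>x. x \<noteq> 0 \<and> u - v = x\<^sup>2)} \<rparr>"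

lemma finite_field_power_card_minus_1:
  fixes a :: "'a::{finite, field}"
  assumes "a \<noteq> 0"
  shows "a ^ (CARD('a) - 1) = 1"
proof -
  let ?U = "UNIV - {0::'a}"
  have "(\<Prod>x\<in>?U. x) = (\<Prod>x\<in>?U. a * x)"
    by (rule prod.reindex_bij_witness[where i = "\<lambda>x. a * x" and j = "\<lambda>x. x / a"])
       (use assms in auto)
  also have "\<dots> = a ^ (CARD('a) - 1) * (\<Prod>x\<in>?U. x)"
    by (simp add: prod.distrib card_Diff_singleton)
  finally show ?thesis by simp
qed

lemma minus_one_square:
  assumes "CARD('a::{finite, field}) mod 4 = 1"
  shows "\<exists>i::'a. i\<^sup>2 = -1"
proof -
  define k where "k = CARD('a) div 4"
  have q: "CARD('a) = 4 * k + 1"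
    using assms unfolding k_def by presburger
  have "card {0, 1::'a} \<le> CARD('a)" by (intro card_mono) auto
  with q have "k > 0" by (cases k) auto
  let ?p = "monom 1 (2 * k) - 1 :: 'a poly"
  have "coeff ?p (2 * k) = 1" using \<open>k > 0\<close> by simp
  hence "?p \<noteq> 0" by (metis coeff_0 zero_neq_one)
  hence "card {x. poly ?p x = 0} \<le> degree ?p" by (rule card_poly_roots_bound)
  also have "degree ?p \<le> 2 * k"
    by (rule degree_diff_le) (auto simp: degree_monom_le)
  finally have le: "card {x. poly ?p x = 0} \<le> 2 * k" .
  have "\<not> UNIV - {0} \<subseteq> {x. poly ?p x = 0}"
  proof
    assume "UNIV - {0} \<subseteq> {x. poly ?p x = 0}"
    hence "card (UNIV - {0::'a}) \<le> 2 * k" using le card_mono[OF finite] le_trans by blast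
    with q \<open>k > 0\<close> show False by (simp add: card_Diff_singleton)
  qed
  then obtain a :: 'a where a: "a \<noteq> 0" "a ^ (2 * k) \<noteq> 1" by (auto simp: poly_monom)
  have "(a ^ (2 * k))\<^sup>2 = 1"
    using finite_field_power_card_minus_1[OF a(1)] q by (simp flip: power_mult add: mult.commute)
  with a(2) have "a ^ (2 * k) = -1" by (simp add: power2_eq_1_iff)
  hence "(a ^ k)\<^sup>2 = -1" by (simp flip: power_mult add: mult.commute)
  thus ?thesis by blast
qed

lemma graph_paley_graph:
  assumes "CARD('a::{finite, field}) mod 4 = 1"
  shows "graph (paley_graph :: ('a, 'a \<times> 'a) pre_digraph)"
proof -
  obtain i :: 'a where i: "i\<^sup>2 = -1" using minus_one_square[OF assms] by blast
  have "\<exists>y. y \<noteq> 0 \<and> v - u = y\<^sup>2" if "x \<noteq> 0" "u - v = x\<^sup>2" for u v x :: 'a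
    using that i by (intro exI[of _ "i * x"]) (auto simp: power_mult_distrib simp flip: that(2))
  thus ?thesis unfolding paley_graph_def
    by (intro pair_graph.pair_graphD_graph, unfold_locales)
       (auto simp: symmetric_def intro!: symI)
qed

end

theory Submission
  imports Defs "HOL-Algebra.Exponent"
begin

text \<open>Let \<open>q = 2m + 1\<close>; distinct vertices \<open>x, y\<close> are adjacent iff \<open>(x - y)\<^sup>m = 1\<close>, and otherwise
  \<open>(x - y)\<^sup>m = -1\<close>. Every element is a sum of two squares, so the diameter is 2, and the affine maps
  \<open>x \<mapsto> a x + b\<close> with \<open>a\<close> a nonzero square give distance transitivity.

  Geodesic transitivity fails for large \<open>q\<close> because an automorphism \<open>f\<close> fixing 0 and 1 is a power of
  Frobenius (Carlitz). Such an \<open>f\<close> satisfies \<open>(f x - f y)\<^sup>m = (x - y)\<^sup>m\<close>. Hence composition with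
  \<open>f\<close> preserves the span of the functions \<open>(x - y)\<^sup>m\<close>, which is the span of the \<open>x\<^sup>k\<close> such that
  \<open>m choose k\<close> is nonzero in the field. For these \<open>k\<close> the function \<open>f\<^sup>k\<close> is therefore a polynomial
  \<open>P\<^sub>k\<close> of degree at most \<open>m\<close>, and \<open>P\<^sub>k P\<^bsub>m-k\<^esub> = X\<^sup>m\<close> makes it a monomial. Since \<open>x\<close> is itself a
  combination of such \<open>f\<^sup>k\<close>, some \<open>P\<^sub>j\<close> is \<open>X\<close>; splitting off from \<open>j\<close> the power \<open>p\<^sup>s\<close> of \<open>p\<close> that
  exactly divides it gives \<open>P\<^sub>j = P\<^bsub>p^s\<^esub> P\<^bsub>j-p^s\<^esub>\<close> and forces \<open>f\<^bsup>p^s\<^esup>\<close> to be the identity function.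

  The arc \<open>(0, 1)\<close> extends to \<open>(q - 1) / 4\<close> geodesics of length 2, while for \<open>q = p\<^sup>r\<close> there are at most
  \<open>r\<close> such \<open>f\<close>. Hence \<open>q - 1 \<le> 4 r\<close>, i.e. \<open>q\<close> is 5 or 9. For \<open>q = 5\<close> this extension is unique, and for
  \<open>q = 9\<close> the two extensions are exchanged by Frobenius.\<close>

section \<open>Power sums and polynomials over finite fields\<close>

lemma CARD_field_ge_2: "2 \<le> CARD('a::{finite, field})"
proof -
  have "card {0, 1 :: 'a} \<le> CARD('a)" by (intro card_mono) auto
  thus ?thesis by simp
qed

lemma of_nat_CARD: "of_nat (CARD('a)) = (0 :: 'a::{finite, field})"
  by (simp add: of_nat_eq_0_iff_char_dvd CHAR_dvd_CARD)

lemma poly_eqI_card: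
  fixes P Q :: "'a::{finite, field} poly"
  assumes "\<And>x. poly P x = poly Q x" "degree P < CARD('a)" "degree Q < CARD('a)"
  shows "P = Q"
  using assms by (intro poly_eqI_degree[of UNIV]) auto

lemma card_roots_of_power:
  fixes c :: "'a::field"
  assumes "0 < n"
  shows "card {x. x ^ n = c} \<le> n"
proof -
  let ?P = "monom 1 n - [:c:]"
  have "coeff ?P n = 1" using assms by (cases n) auto
  hence "?P \<noteq> 0" by (metis coeff_0 zero_neq_one)
  hence "card {x. poly ?P x = 0} \<le> degree ?P" by (rule card_poly_roots_bound)
  also have "degree ?P \<le> n" by (rule degree_diff_le) (auto simp: degree_monom_le)
  finally show ?thesis by (simp add: poly_monom)
qed

text \<open>If some nonzero \<open>a\<close> has \<open>a ^ e \<noteq> 1\<close>, replacing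
  \<open>x\<close> by \<open>a * x\<close> multiplies the sum by \<open>a ^ e\<close>, so it
  vanishes. Otherwise every nonzero term is 1, and their number \<open>CARD('a) - 1\<close> is -1 in
  the field.\<close>

lemma sum_powers_finite_field:
  fixes e :: nat
  assumes "0 < e"
  shows "(\<Sum>x\<in>UNIV. x ^ e) = (if CARD('a) - 1 dvd e then -1 else (0 :: 'a::{finite, field}))"
proof (cases "CARD('a) - 1 dvd e")
  case True
  then obtain k where k: "e = (CARD('a) - 1) * k" by auto
  have "(\<Sum>x\<in>UNIV. x ^ e) = (\<Sum>x\<in>UNIV - {0::'a}. x ^ e)"
    using assms by (intro sum.mono_neutral_right) auto
  also have "\<dots> = (\<Sum>x\<in>UNIV - {0::'a}. 1)"
    by (intro sum.cong) (auto simp: k power_mult finite_field_power_card_minus_1 simp del: One_nat_def)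
  also have "\<dots> = of_nat (CARD('a) - 1)" by (simp add: card_Diff_singleton)
  also have "\<dots> = of_nat (CARD('a)) - 1" using CARD_field_ge_2[where 'a='a] by (subst of_nat_diff) auto
  also have "of_nat (CARD('a)) = (0::'a)" by (rule of_nat_CARD)
  finally show ?thesis using True by simp
next
  case False
  define r where "r = e mod (CARD('a) - 1)"
  have r: "0 < r" "r < CARD('a) - 1"
    using False CARD_field_ge_2[where 'a='a] by (auto simp: r_def dvd_eq_mod_eq_0)
  have "\<not> UNIV - {0::'a} \<subseteq> {x. x ^ r = 1}"
  proof
    assume "UNIV - {0::'a} \<subseteq> {x. x ^ r = 1}"
    hence "card (UNIV - {0::'a}) \<le> card {x::'a. x ^ r = 1}" by (intro card_mono) auto
    also have "\<dots> \<le> r" by (rule card_roots_of_power) fact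
    finally show False using r by (simp add: card_Diff_singleton)
  qed
  then obtain a :: 'a where a: "a \<noteq> 0" "a ^ r \<noteq> 1" by auto
  have "a ^ e = a ^ ((CARD('a) - 1) * (e div (CARD('a) - 1)) + r)" by (simp add: r_def)
  also have "\<dots> = a ^ r" by (simp only: power_add power_mult finite_field_power_card_minus_1[OF a(1)]) simp
  finally have ae: "a ^ e \<noteq> 1" using a by simp
  have "(\<Sum>x\<in>UNIV. x ^ e) = (\<Sum>x\<in>UNIV. (a * x) ^ e)"
    by (rule sum.reindex_bij_witness[where i = "\<lambda>x. a * x" and j = "\<lambda>x. x / a"])
       (use a in auto)
  also have "\<dots> = a ^ e * (\<Sum>x\<in>UNIV. x ^ e)" by (simp add: power_mult_distrib sum_distrib_left)
  finally have "(a ^ e - 1) * (\<Sum>x\<in>UNIV. x ^ e) = 0" by (simp add: algebra_simps)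
  thus ?thesis using ae False by simp
qed

lemma power_in_span_of_shifted_powers:
  assumes q: "CARD('a::{finite, field}) = 2 * m + 1"
    and "k \<le> m" and C: "of_nat (m choose k) \<noteq> (0 :: 'a)"
  shows "\<exists>c :: 'a \<Rightarrow> 'a. \<forall>x. x ^ k = (\<Sum>u\<in>UNIV. c u * (x - u) ^ m)"
proof -
  have m: "m > 0" using q CARD_field_ge_2[where 'a='a] by simp
  \<comment> \<open>The exponent lies strictly between 0 and \<open>4 * m\<close>, so the only
    multiple of \<open>CARD('a) - 1 = 2 * m\<close> it can equal is \<open>2 * m\<close> itself,
    which happens exactly for \<open>j = k\<close>.\<close>
  have powsum: "(\<Sum>u\<in>UNIV. u ^ (m + k + (m - j))) = (if j = k then -1 else (0::'a))" if "j \<le> m" for j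
  proof -
    have "CARD('a) - 1 dvd m + k + (m - j) \<longleftrightarrow> j = k"
    proof
      assume "CARD('a) - 1 dvd m + k + (m - j)"
      then obtain t where t: "m + k + (m - j) = 2 * m * t" using q by (auto elim!: dvdE)
      have "0 < 2 * m * t" "2 * m * t < 2 * m * 2" using t that \<open>k \<le> m\<close> m by linarith+
      hence "t = 1" by (auto simp only: mult_less_cancel1) (auto intro: ccontr)
      thus "j = k" using t that \<open>k \<le> m\<close> by auto
    next
      assume "j = k"
      thus "CARD('a) - 1 dvd m + k + (m - j)" using q that by (simp flip: mult_2)
    qed
    thus ?thesis using m by (subst sum_powers_finite_field) auto
  qed
  \<comment> \<open>Weighting \<open>(x - u)\<^sup>m\<close> by \<open>u\<^sup>m\<^sup>+\<^sup>k\<close> and summing over \<open>u\<close> isolates the \<open>x\<^sup>k\<close> term of the binomial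
    expansion; \<open>b\<close> is what remains of its coefficient.\<close>
  define b :: 'a where "b = - ((-1) ^ (m - k) * of_nat (m choose k))"
  have b: "b \<noteq> 0" using C by (simp add: b_def)
  have "x ^ k = (\<Sum>u\<in>UNIV. u ^ (m + k) / b * (x - u) ^ m)" for x :: 'a
  proof -
    have "(\<Sum>u\<in>UNIV. u ^ (m + k) * (x - u) ^ m) =
      (\<Sum>u\<in>UNIV. \<Sum>j\<le>m. of_nat (m choose j) * x ^ j * (-1) ^ (m - j) * u ^ (m + k + (m - j)))"
    proof (intro sum.cong refl)
      fix u :: 'a
      have "(x - u) ^ m = (\<Sum>j\<le>m. of_nat (m choose j) * x ^ j * (- u) ^ (m - j))"
        using binomial_ring[of x "-u" m] by simp
      also have "u ^ (m + k) * \<dots> = (\<Sum>j\<le>m. of_nat (m choose j) * x ^ j * (-1) ^ (m - j) * u ^ (m + k + (m - j)))"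
        unfolding sum_distrib_left
        by (intro sum.cong refl) (simp only: power_minus[of u] power_add mult_ac)
      finally show "u ^ (m + k) * (x - u) ^ m =
        (\<Sum>j\<le>m. of_nat (m choose j) * x ^ j * (-1) ^ (m - j) * u ^ (m + k + (m - j)))" .
    qed
    also have "\<dots> = (\<Sum>j\<le>m. of_nat (m choose j) * x ^ j * (-1) ^ (m - j) * (\<Sum>u\<in>UNIV. u ^ (m + k + (m - j))))"
      by (subst sum.swap) (simp add: sum_distrib_left)
    also have "\<dots> = (\<Sum>j\<le>m. if j = k then b * x ^ k else 0)"
      by (intro sum.cong refl, subst powsum) (auto simp: b_def)
    also have "\<dots> = b * x ^ k" using \<open>k \<le> m\<close> by simp
    finally show ?thesis using b by (simp add: field_simps flip: sum_divide_distrib)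
  qed
  thus ?thesis by (intro exI[of _ "\<lambda>u. u ^ (m + k) / b"] allI)
qed

text \<open>For each factor the order at 0 is at most the degree. Orders and degrees both add up to
  \<open>n\<close>, so they agree and no factor has anything besides a power of X and a
  constant.\<close>

lemma factor_of_monom:
  fixes P Q :: "'a::field poly"
  assumes "P * Q = monom 1 n"
  shows "\<exists>a d. a \<noteq> 0 \<and> d \<le> n \<and> P = monom a d"
proof -
  have nz: "P \<noteq> 0" "Q \<noteq> 0" "P * Q \<noteq> 0" using assms by auto
  have X: "monom 1 n = [:-0, 1::'a:] ^ n" by (simp add: monom_altdef)
  have "order 0 P + order 0 Q = n"
    using order_mult[OF nz(3), of 0] unfolding assms X order_power_n_n by simp
  moreover have "degree P + degree Q = n"
    using degree_mult_eq[OF nz(1,2)] unfolding assms by (simp add: degree_monom_eq)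
  ultimately have d: "order 0 P = degree P" "degree P \<le> n"
    using order_degree[OF nz(1), of 0] order_degree[OF nz(2), of 0] by auto
  obtain R where R: "P = [:-0, 1:] ^ degree P * R" using order_1[of 0 P] d by (auto elim: dvdE)
  hence "R \<noteq> 0" using nz by auto
  hence "degree R = 0" using R nz by (metis add_right_imp_eq add_0 degree_mult_eq degree_linear_power mult_zero_left add.commute)
  then obtain a where a: "R = [:a:]" by (auto elim: degree_eq_zeroE)
  have "P = monom a (degree P)" by (subst R) (simp add: a monom_altdef)
  thus ?thesis using d \<open>R \<noteq> 0\<close> a by (intro exI[of _ a] exI[of _ "degree P"]) auto
qed

section \<open>Bijections preserving the quadratic character\<close>

locale quadratic_character_map =
  fixes f :: "'a::{finite, field} \<Rightarrow> 'a" and m :: nat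
  assumes q: "CARD('a) = 2 * m + 1"
    and bij: "bij f" and f0: "f 0 = 0" and f1: "f 1 = 1"
    and pres: "\<And>x y. (f x - f y) ^ m = (x - y) ^ m"
begin

lemma m_pos: "0 < m" using q CARD_field_ge_2[where 'a='a] by simp

text \<open>In the span representation evaluated at \<open>f x\<close>, writing the shifts as
  \<open>u = f y\<close> lets \<open>pres\<close> replace each \<open>f x - f y\<close> by
  \<open>x - y\<close>; what remains is a polynomial in \<open>x\<close>.\<close>

lemma power_polynomial:
  assumes "k \<le> m" "of_nat (m choose k) \<noteq> (0 :: 'a)"
  shows "\<exists>P. degree P \<le> m \<and> (\<forall>x. poly P x = f x ^ k)"
proof -
  obtain c :: "'a \<Rightarrow> 'a" where c: "\<And>x. x ^ k = (\<Sum>u\<in>UNIV. c u * (x - u) ^ m)"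
    using power_in_span_of_shifted_powers[OF q assms] by blast
  let ?P = "\<Sum>y\<in>UNIV. smult (c (f y)) ([:-y, 1:] ^ m)"
  have "degree ?P \<le> m"
    by (intro degree_sum_le) (auto intro!: order.trans[OF degree_smult_le] simp: degree_linear_power)
  moreover have "poly ?P x = f x ^ k" for x
  proof -
    have "f x ^ k = (\<Sum>u\<in>UNIV. c u * (f x - u) ^ m)" by (rule c)
    also have "\<dots> = (\<Sum>y\<in>UNIV. c (f y) * (f x - f y) ^ m)"
      by (rule sum.reindex_bij_betw[OF bij, symmetric])
    finally show ?thesis by (simp add: poly_sum pres)
  qed
  ultimately show ?thesis by blast
qed

lemma power_monomial:
  assumes k: "k \<le> m" and C: "of_nat (m choose k) \<noteq> (0 :: 'a)"
  shows "\<exists>d\<le>m. \<forall>x. f x ^ k = x ^ d"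
proof -
  obtain P where P: "degree P \<le> m" "\<And>x. poly P x = f x ^ k" using power_polynomial[OF k C] by blast
  have "of_nat (m choose (m - k)) \<noteq> (0 :: 'a)" using C binomial_symmetric[OF k] by simp
  then obtain Q where Q: "degree Q \<le> m" "\<And>x. poly Q x = f x ^ (m - k)"
    using power_polynomial[of "m - k"] by auto
  \<comment> \<open>\<open>f\<close> preserves the \<open>m\<close>-th power, so the polynomials of \<open>f\<^sup>k\<close> and \<open>f\<^sup>m\<^sup>-\<^sup>k\<close> are complementary
    divisors of \<open>X\<^sup>m\<close>.\<close>
  have "P * Q = monom 1 m"
  proof (rule poly_eqI_card)
    fix x
    have "poly (P * Q) x = f x ^ m" using k by (simp add: P Q flip: power_add)
    thus "poly (P * Q) x = poly (monom 1 m) x" using pres[of x 0] by (simp add: f0 poly_monom)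
    show "degree (P * Q) < CARD('a)" using degree_mult_le[of P Q] P(1) Q(1) q by linarith
    show "degree (monom (1::'a) m) < CARD('a)" using q by (simp add: degree_monom_eq)
  qed
  then obtain a d where ad: "d \<le> m" "P = monom a d" using factor_of_monom by blast
  hence "a = 1" using P(2)[of 1] f1 by (simp add: poly_monom)
  thus ?thesis using ad P(2) by (auto simp: poly_monom)
qed

lemma power_identity:
  "\<exists>j. 0 < j \<and> j \<le> m \<and> of_nat (m choose j) \<noteq> (0::'a) \<and> (\<forall>x. f x ^ j = x)"
proof -
  \<comment> \<open>Since \<open>2 * m + 1\<close> vanishes in the field, \<open>m\<close> does not,
    so the exponent 1 is among the admissible ones.\<close>
  have "2 * of_nat m + 1 = (0::'a)" using of_nat_CARD[where 'a='a] by (simp add: q add.commute)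
  hence "of_nat (m choose 1) \<noteq> (0::'a)" by auto
  then obtain c :: "'a \<Rightarrow> 'a" where c: "\<And>x. x ^ 1 = (\<Sum>u\<in>UNIV. c u * (x - u) ^ m)"
    using power_in_span_of_shifted_powers[OF q, of 1] m_pos by auto
  define J where "J = {j. j \<le> m \<and> of_nat (m choose j) \<noteq> (0::'a)}"
  have "\<forall>j\<in>J. \<exists>d\<le>m. \<forall>x. f x ^ j = x ^ d" using power_monomial by (auto simp: J_def)
  then obtain D where D: "\<And>j. j \<in> J \<Longrightarrow> D j \<le> m" "\<And>j x. j \<in> J \<Longrightarrow> f x ^ j = x ^ D j" by metis
  define b where "b j = (\<Sum>u\<in>UNIV. c u * of_nat (m choose j) * (- f u) ^ (m - j))" for j
  have exp: "x = (\<Sum>j\<in>J. b j * x ^ D j)" for x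
  proof -
    have "x = (\<Sum>u\<in>UNIV. c u * (f x - f u) ^ m)" using c[of x] by (simp add: pres)
    also have "\<dots> = (\<Sum>u\<in>UNIV. c u * (\<Sum>j\<le>m. of_nat (m choose j) * f x ^ j * (- f u) ^ (m - j)))"
      using binomial_ring[of "f x" "- f _" m] by simp
    also have "\<dots> = (\<Sum>j\<le>m. b j * f x ^ j)"
      unfolding b_def sum_distrib_left sum_distrib_right
      by (subst sum.swap) (simp add: mult_ac)
    \<comment> \<open>Outside \<open>J\<close> the binomial coefficient inside \<open>b j\<close> is
      zero.\<close>
    also have "\<dots> = (\<Sum>j\<in>J. b j * f x ^ j)"
      by (intro sum.mono_neutral_right) (auto simp: J_def b_def)
    finally show ?thesis by (simp add: D)
  qed
  have "finite J" by (simp add: J_def)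
  have "monom 1 1 = (\<Sum>j\<in>J. monom (b j) (D j))"
  proof (rule poly_eqI_card)
    show "poly (monom 1 1) x = poly (\<Sum>j\<in>J. monom (b j) (D j)) x" for x
      using exp[of x] by (simp add: poly_sum poly_monom)
    show "degree (monom (1::'a) 1) < CARD('a)" using q m_pos by (simp add: degree_monom_eq)
    have "degree (\<Sum>j\<in>J. monom (b j) (D j)) \<le> m"
      using \<open>finite J\<close> D(1) by (intro degree_sum_le) (auto intro: order.trans[OF degree_monom_le])
    thus "degree (\<Sum>j\<in>J. monom (b j) (D j)) < CARD('a)" using q by simp
  qed
  hence "coeff (monom (1::'a) 1) 1 = coeff (\<Sum>j\<in>J. monom (b j) (D j)) 1" by simp
  hence "(\<Sum>j\<in>J. coeff (monom (b j) (D j)) 1) \<noteq> 0" by (simp add: coeff_sum)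
  then obtain j where j: "j \<in> J" "coeff (monom (b j) (D j)) 1 \<noteq> 0" by (meson sum.neutral)
  hence "D j = 1" by (simp split: if_splits)
  hence *: "f x ^ j = x" for x using D(2)[OF j(1)] by simp
  moreover have "0 < j" using *[of 0] by (cases j) auto
  ultimately show ?thesis using j(1) by (auto simp: J_def)
qed

text \<open>So \<open>f\<close> is the inverse of a Frobenius power. The bound by \<open>m\<close>
  later limits \<open>s\<close> to fewer values than the degree of the field over its prime
  field.\<close>

lemma power_CHAR_identity: "\<exists>s. CHAR('a) ^ s \<le> m \<and> (\<forall>x. f x ^ (CHAR('a) ^ s) = x)"
proof -
  define p where "p = CHAR('a)"
  have p: "prime p" unfolding p_def
    by (rule prime_CHAR_semidom) (simp add: finite_imp_CHAR_pos)
  obtain j where j: "0 < j" "j \<le> m" "of_nat (m choose j) \<noteq> (0::'a)" "\<And>x. f x ^ j = x"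
    using power_identity by blast
  define s where "s = multiplicity p j"
  obtain t where t: "j = p ^ s * t" "\<not> p dvd t"
    using j p unfolding s_def by (metis multiplicity_decompose' not_prime_unit less_numeral_extra(3))
  have "t > 0" using t by (cases t) auto
  have le: "p ^ s \<le> j" using t(1) \<open>t > 0\<close> by simp
  \<comment> \<open>The multiplicity of \<open>p\<close> in \<open>p ^ s * t choose p ^ s\<close>
    equals that in \<open>t\<close>, which is 0.\<close>
  have "multiplicity p (j choose p ^ s) = 0"
    using const_p_fac[OF \<open>t > 0\<close> p, of s] t by (simp add: not_dvd_imp_multiplicity_0)
  hence "\<not> p dvd (j choose p ^ s)"
    using le prime_elem_multiplicity_eq_zero_iff[of p "j choose p ^ s"] p by auto
  hence "of_nat (j choose p ^ s) \<noteq> (0::'a)" by (simp add: of_nat_eq_0_iff_char_dvd p_def)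
  hence nz: "of_nat ((m choose j) * (j choose p ^ s)) \<noteq> (0::'a)" using j by simp
  have "of_nat (m choose p ^ s) \<noteq> (0::'a)"
    using nz choose_mult[OF le j(2)] by (metis mult_zero_left of_nat_mult)
  then obtain d where d: "\<And>x. f x ^ (p ^ s) = x ^ d" "d \<le> m"
    using power_monomial[of "p ^ s"] le j by auto
  \<comment> \<open>By the choice of \<open>s\<close>, both \<open>p\<^sup>s\<close> and \<open>j - p\<^sup>s\<close> are exponents to which \<open>power_monomial\<close> applies;
    the degrees of the two monomials add up to 1.\<close>
  have "(m choose j) * (j choose (j - p ^ s)) = (m choose (j - p ^ s)) * ((m - (j - p ^ s)) choose (j - (j - p ^ s)))"
    by (rule choose_mult) (use j in auto)
  hence "of_nat (m choose (j - p ^ s)) \<noteq> (0::'a)"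
    using nz binomial_symmetric[OF le] by (metis mult_zero_left of_nat_mult)
  then obtain e where e: "\<And>x. f x ^ (j - p ^ s) = x ^ e" "e \<le> m"
    using power_monomial[of "j - p ^ s"] le_trans[OF diff_le_self j(2)] by blast
  have "monom (1::'a) (d + e) = monom 1 1"
  proof (rule poly_eqI_card)
    fix x
    have "x ^ (d + e) = f x ^ (p ^ s + (j - p ^ s))" unfolding power_add d e ..
    also have "\<dots> = x" using le j by simp
    finally show "poly (monom 1 (d + e)) x = poly (monom 1 1) x" by (simp add: poly_monom)
  qed (use d e q m_pos in \<open>auto simp: degree_monom_eq\<close>)
  hence "d + e = 1" by (metis degree_monom_eq one_neq_zero)
  moreover have "d \<noteq> 0"
  proof
    assume "d = 0"
    hence "(0::'a) ^ (p ^ s) = 1" using d(1)[of 0] f0 by simp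
    thus False using p by (simp add: zero_power prime_gt_0_nat)
  qed
  ultimately have "d = 1" by simp
  thus ?thesis using d le j by (intro exI[of _ s]) (auto simp: p_def)
qed

end

section \<open>Squares in finite fields\<close>

lemma one_neq_minus_one:
  assumes "CARD('a::{finite, field}) = 2 * m + 1"
  shows "(1 :: 'a) \<noteq> -1"
proof
  assume *: "(1 :: 'a) = -1"
  have "of_nat (2 * m + 1) = (0 :: 'a)" using of_nat_CARD[where 'a='a] assms by simp
  hence "(1 + 1) * of_nat m + 1 = (0 :: 'a)" by (simp add: algebra_simps)
  moreover have "1 + 1 = (0 :: 'a)" using * by (metis add.right_inverse)
  ultimately show False by simp
qed

lemma power_half_cases:
  assumes "CARD('a::{finite, field}) = 2 * m + 1" and "z \<noteq> (0 :: 'a)"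
  shows "z ^ m = 1 \<or> z ^ m = -1"
proof -
  have "(z ^ m)\<^sup>2 = 1"
    using finite_field_power_card_minus_1[OF assms(2)] assms(1)
    by (simp flip: power_mult add: mult.commute)
  thus ?thesis by (simp add: power2_eq_1_iff)
qed

text \<open>Each element has at most two square roots, so there are at least \<open>m\<close>
  nonzero squares; all of them lie among the at most \<open>m\<close> roots of
  \<open>z ^ m = 1\<close>.\<close>

lemma nonzero_squares_eq_roots:
  assumes q: "CARD('a::{finite, field}) = 2 * m + 1"
  shows "{z :: 'a. \<exists>x. x \<noteq> 0 \<and> z = x\<^sup>2} = {z. z ^ m = 1}" (is "?Q = ?R")
    and "card {z :: 'a. z ^ m = 1} = m"
proof -
  have m: "m > 0" using q CARD_field_ge_2[where 'a='a] by simp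
  have sub: "?Q \<subseteq> ?R"
  proof
    fix z assume "z \<in> ?Q"
    then obtain x where "x \<noteq> 0" "z = x\<^sup>2" by blast
    thus "z \<in> ?R" using finite_field_power_card_minus_1[of x] q by (simp flip: power_mult)
  qed
  have "2 * m = card (UNIV - {0 :: 'a})" using q by (simp add: card_Diff_singleton)
  also have "\<dots> \<le> card (\<Union>z\<in>?Q. {x. x ^ 2 = z})" by (intro card_mono) auto
  also have "\<dots> \<le> (\<Sum>z\<in>?Q. card {x. x ^ 2 = z})" by (intro card_UN_le) auto
  also have "\<dots> \<le> (\<Sum>z\<in>?Q. 2)" by (intro sum_mono card_roots_of_power) auto
  finally have "m \<le> card ?Q" by simp
  moreover have "card ?R \<le> m" using m by (rule card_roots_of_power)
  moreover have "card ?Q \<le> card ?R" using sub by (intro card_mono) auto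
  ultimately have "card ?R = m" "card ?Q = card ?R" by linarith+
  thus "?Q = ?R" "card ?R = m" using card_subset_eq[OF finite sub] by blast+
qed

lemma nonzero_square_iff:
  assumes "CARD('a::{finite, field}) = 2 * m + 1"
  shows "(\<exists>x. x \<noteq> 0 \<and> z = x\<^sup>2) \<longleftrightarrow> z ^ m = (1 :: 'a)"
  using nonzero_squares_eq_roots(1)[OF assms] by blast

text \<open>The squares, 0 included, make up more than half of the field, so \<open>S\<close> and
  \<open>z - S\<close> must meet.\<close>

lemma sum_of_two_squares:
  assumes q: "CARD('a::{finite, field}) = 2 * m + 1"
  shows "\<exists>x y :: 'a. z = x\<^sup>2 + y\<^sup>2"
proof -
  have m: "m > 0" using q CARD_field_ge_2[where 'a='a] by simp
  define S where "S = insert 0 {s :: 'a. s ^ m = 1}"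
  have S: "\<exists>x. s = x\<^sup>2" if "s \<in> S" for s
    using that nonzero_square_iff[OF q, of s] by (auto simp: S_def intro: exI[of _ 0])
  have "card S = m + 1" using nonzero_squares_eq_roots(2)[OF q] m by (simp add: S_def power_0_left)
  moreover have "card ((\<lambda>s. z - s) ` S) = card S" by (intro card_image) (auto simp: inj_on_def)
  ultimately have "card S + card ((\<lambda>s. z - s) ` S) > CARD('a)" using q by simp
  moreover have "card (S \<union> (\<lambda>s. z - s) ` S) \<le> CARD('a)" by (intro card_mono) auto
  ultimately have "S \<inter> (\<lambda>s. z - s) ` S \<noteq> {}" by (auto dest!: card_Un_disjoint[of S, rotated 2])
  then obtain s t where "s \<in> S" "t \<in> S" "s = z - t" by blast
  thus ?thesis using S by (metis add.commute diff_add_cancel)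
qed

lemma even_power_minus_commute:
  "(x - y) ^ (2 * k) = (y - x :: 'a::comm_ring_1) ^ (2 * k)"
  by (simp add: power_mult power2_commute)

lemma card_half_powers:
  assumes q: "CARD('a::{finite, field}) = 4 * k + 1"
  shows "card {n :: 'a. n ^ (2 * k) = -1 \<and> (n - 1) ^ (2 * k) = 1} = k"
proof -
  define m where "m = 2 * k"
  have qm: "CARD('a) = 2 * m + 1" by (simp add: q m_def)
  have m: "m > 0" using qm CARD_field_ge_2[where 'a='a] by simp
  have ev: "even m" by (simp add: m_def)
  note neq = one_neq_minus_one[OF qm]
  define A where "A = {n :: 'a. n ^ m = -1 \<and> (n - 1) ^ m = 1}"
  define B where "B = {x :: 'a. x ^ m = -1 \<and> (x + 1) ^ m = 1}"
  define C where "C = {x :: 'a. x ^ m = -1 \<and> (x + 1) ^ m = -1}"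
  have minus: "(1 - x) ^ m = (x - 1) ^ m" "(- x - 1) ^ m = (x + 1) ^ m" for x :: 'a
    using even_power_minus_commute[of 1 x k] even_power_minus_commute[of "- x" 1 k]
    by (simp_all add: m_def add.commute)
  have "bij_betw uminus A B"
    by (rule bij_betwI[of _ _ _ uminus]) (use ev in \<open>auto simp: A_def B_def minus\<close>)
  hence AB: "card A = card B" by (rule bij_betw_same_card)
  \<comment> \<open>\<open>x \<mapsto> 1/x\<close> turns non-squares \<open>x\<close> with \<open>x + 1\<close> a square into those with \<open>x + 1\<close> a non-square, so these
    two kinds share the \<open>m\<close> non-squares equally.\<close>
  have inv: "(inverse x + 1) ^ m = - ((x + 1) ^ m)" if "x ^ m = -1" for x :: 'a
  proof -
    have "x \<noteq> 0" using that m by (auto simp: power_0_left)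
    hence "inverse x + 1 = (x + 1) * inverse x" by (simp add: field_simps)
    thus ?thesis using that by (simp add: power_mult_distrib power_inverse)
  qed
  have "bij_betw inverse B C"
    by (rule bij_betwI[of _ _ _ inverse]) (auto simp: B_def C_def inv power_inverse)
  hence BC: "card B = card C" by (rule bij_betw_same_card)
  have "B \<union> C = {x. x ^ m = -1}"
  proof -
    have "(x + 1) ^ m = 1 \<or> (x + 1) ^ m = -1" if "x ^ m = -1" for x :: 'a
    proof (rule power_half_cases[OF qm])
      \<comment> \<open>As \<open>m\<close> is even, -1 has \<open>m\<close>-th power 1 and is not a
        non-square.\<close>
      show "x + 1 \<noteq> 0" using that ev neq by (auto simp: add_eq_0_iff2)
    qed
    thus ?thesis by (auto simp: B_def C_def)
  qed
  moreover have "B \<inter> C = {}" using neq by (auto simp: B_def C_def)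
  ultimately have "card B + card C = card {x :: 'a. x ^ m = -1}"
    by (metis card_Un_disjoint finite)
  also have "{x :: 'a. x ^ m = -1} = UNIV - insert 0 {x. x ^ m = 1}"
    using power_half_cases[OF qm] neq m by (auto simp: power_0_left)
  also have "card \<dots> = m"
    using nonzero_squares_eq_roots(2)[OF qm] qm m by (subst card_Diff_subset) (auto simp: power_0_left)
  finally have "card A = k" using AB BC by (simp add: m_def)
  thus ?thesis by (simp add: A_def m_def)
qed

section \<open>Small prime powers and the characteristic\<close>

lemma three_power_bound: "3 \<le> r \<Longrightarrow> 4 * r + 1 < (3::nat) ^ r"
  by (induction r rule: dec_induct) auto

text \<open>As \<open>p\<close> is odd, \<open>3 ^ r \<le> p ^ r \<le> 4 * r + 1\<close>, which
  leaves only \<open>r = 1\<close> with \<open>k = 1\<close> and \<open>r = 2\<close> with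
  \<open>k = 2\<close>.\<close>

lemma prime_power_small:
  fixes p r k :: nat
  assumes "prime p" "0 < r" "p ^ r = 4 * k + 1" "k \<le> r"
  shows "p ^ r = 5 \<or> p ^ r = 9"
proof -
  have "p \<noteq> 2"
  proof
    assume "p = 2"
    hence "even (p ^ r)" using assms(2) by simp
    thus False using assms(3) by simp
  qed
  hence p: "3 \<le> p" using prime_ge_2_nat[OF assms(1)] by simp
  have le: "3 ^ r \<le> p ^ r" using p by (rule power_mono) simp
  have "r < 3"
  proof (rule ccontr)
    assume "\<not> r < 3"
    hence "4 * r + 1 < (3::nat) ^ r" by (intro three_power_bound) simp
    thus False using le assms by linarith
  qed
  then consider "r = 1" | "r = 2" using assms(2) by linarith
  thus ?thesis
  proof cases
    case 1
    hence "k = 1" using p assms by (cases k) auto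
    thus ?thesis using assms by simp
  next
    case 2
    hence "k = 2" using le assms by auto
    thus ?thesis using assms by simp
  qed
qed

lemma finite_field_prime_power:
  assumes "primepow (CARD('a::{finite, field}))"
  shows "prime CHAR('a) \<and> (\<exists>r>0. CARD('a) = CHAR('a) ^ r)"
proof -
  have "prime CHAR('a)" by (rule prime_CHAR_semidom) (simp add: finite_imp_CHAR_pos)
  moreover obtain p r where pr: "prime p" "r > 0" "CARD('a) = p ^ r"
    using assms by (auto simp: primepow_def)
  ultimately have "CHAR('a) = p"
    using CHAR_dvd_CARD[where 'a='a] by (metis prime_dvd_power primes_dvd_imp_eq)
  thus ?thesis using pr by auto
qed

section \<open>Distances and automorphisms of Paley graphs\<close>

lemma verts_paley [simp]: "verts paley_graph = UNIV"
  and tail_paley [simp]: "tail paley_graph = fst"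
  and head_paley [simp]: "head paley_graph = snd"
  by (simp_all add: paley_graph_def)

lemma arcs_paley:
  assumes "CARD('a::{finite, field}) = 2 * m + 1"
  shows "arcs (paley_graph :: ('a, 'a \<times> 'a) pre_digraph) = {(u, v). (u - v) ^ m = 1}"
    and "arcs_ends (paley_graph :: ('a, 'a \<times> 'a) pre_digraph) = {(u, v). (u - v) ^ m = 1}"
proof -
  have "m > 0" using assms CARD_field_ge_2[where 'a='a] by simp
  thus "arcs (paley_graph :: ('a, 'a \<times> 'a) pre_digraph) = {(u, v). (u - v) ^ m = 1}"
    by (auto simp: paley_graph_def nonzero_square_iff[OF assms] power_0_left)
  thus "arcs_ends (paley_graph :: ('a, 'a \<times> 'a) pre_digraph) = {(u, v). (u - v) ^ m = 1}"
    by (simp add: paley_graph_def)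
qed

text \<open>Write \<open>u - v\<close> as a sum of two squares. Both are nonzero, since otherwise
  \<open>u - v\<close> would be a square; one of them is the step from \<open>u\<close> to
  \<open>w\<close>, the other the step from \<open>w\<close> to \<open>v\<close>.\<close>

lemma paley_common_neighbour:
  assumes q: "CARD('a::{finite, field}) = 2 * m + 1" and "u \<noteq> v" "(u - v) ^ m \<noteq> (1 :: 'a)"
  shows "\<exists>w. (u - w) ^ m = 1 \<and> (w - v) ^ m = 1"
proof -
  obtain x y where xy: "u - v = x\<^sup>2 + y\<^sup>2" using sum_of_two_squares[OF q] by blast
  have "x \<noteq> 0" "y \<noteq> 0"
    using xy assms(2,3) nonzero_square_iff[OF q, of "u - v"]
    by (metis add_0 add.right_neutral zero_power2 eq_iff_diff_eq_0)+
  hence "(x\<^sup>2) ^ m = 1" "(y\<^sup>2) ^ m = 1" using nonzero_square_iff[OF q] by blast+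
  moreover have "u - x\<^sup>2 - v = y\<^sup>2" using xy by (simp add: algebra_simps)
  ultimately show ?thesis by (intro exI[of _ "u - x\<^sup>2"]) simp
qed

lemma graph_dist_paley:
  assumes q: "CARD('a::{finite, field}) = 4 * k + 1"
  shows "graph_dist paley_graph u (v :: 'a) =
    (if u = v then 0 else if (u - v) ^ (2 * k) = 1 then 1 else 2)"
proof -
  let ?G = "paley_graph :: ('a, 'a \<times> 'a) pre_digraph"
  define m where "m = 2 * k"
  have qm: "CARD('a) = 2 * m + 1" by (simp add: q m_def)
  interpret graph ?G using q by (intro graph_paley_graph) simp
  note arcs = arcs_paley(1)[OF qm]
  have awalk_cost_unit: "awalk_cost (\<lambda>_. 1) p = real (length p)" for p :: "('a \<times> 'a) awalk"
    by (induction p) auto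
  have upper: "graph_dist ?G u v \<le> ereal (real (length p))" if "awalk u p v" for p
    using min_cost_le_walk_cost[OF that, of "\<lambda>_. 1"] by (simp add: graph_dist_def awalk_cost_unit)
  have lower: "ereal (real n) \<le> graph_dist ?G u v" if "\<And>p. awalk u p v \<Longrightarrow> n \<le> length p" for n
    unfolding graph_dist_def \<mu>_def
    by (rule INF_greatest) (use that in \<open>auto simp: awalk_cost_unit\<close>)
  have len0: "u = v" if "awalk u p v" "length p = 0" for p using that by (simp add: awalk_Nil_iff)
  have len1: "(u - v) ^ m = 1" if "awalk u p v" "length p = 1" for p
    using that by (auto simp: length_Suc_conv awalk_simps arcs)
  consider "u = v" | "u \<noteq> v" "(u - v) ^ m = 1" | "u \<noteq> v" "(u - v) ^ m \<noteq> 1" by blast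
  thus ?thesis
  proof cases
    case 1
    thus ?thesis using upper[of "[]"] lower[of 0] by (simp add: awalk_Nil_iff zero_ereal_def)
  next
    case 2
    hence "awalk u [(u, v)] v" by (simp add: awalk_simps arcs)
    hence "graph_dist ?G u v \<le> 1" using upper[of "[(u, v)]"] by (simp add: one_ereal_def)
    moreover have "ereal (real 1) \<le> graph_dist ?G u v"
    proof (rule lower)
      fix p assume "awalk u p v"
      thus "1 \<le> length p" using len0[of p] 2 by linarith
    qed
    ultimately show ?thesis using 2 by (simp add: m_def one_ereal_def)
  next
    case 3
    then obtain w where w: "(u - w) ^ m = 1" "(w - v) ^ m = 1"
      using paley_common_neighbour[OF qm] by blast
    hence "awalk u [(u, w), (w, v)] v" by (simp add: awalk_simps arcs)
    hence "graph_dist ?G u v \<le> ereal (real 2)" using upper[of "[(u, w), (w, v)]"] by simp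
    moreover have "ereal (real 2) \<le> graph_dist ?G u v"
    proof (rule lower)
      fix p assume "awalk u p v"
      thus "2 \<le> length p" using len0[of p] len1[of p] 3 by linarith
    qed
    ultimately show ?thesis using 3 by (simp add: m_def)
  qed
qed

lemma connected_paley:
  assumes q: "CARD('a::{finite, field}) = 4 * k + 1"
  shows "Digraph_Component.connected (paley_graph :: ('a, 'a \<times> 'a) pre_digraph)"
proof -
  let ?G = "paley_graph :: ('a, 'a \<times> 'a) pre_digraph"
  interpret graph ?G using q by (intro graph_paley_graph) simp
  have "u \<rightarrow>\<^sup>*\<^bsub>?G\<^esub> v" for u v
  proof -
    have "\<mu> (\<lambda>_. 1) u v < \<infinity>" using graph_dist_paley[OF q, of u v] by (simp add: graph_dist_def)
    thus ?thesis by (simp only: \<mu>_reach_conv)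
  qed
  thus ?thesis
    unfolding connected_def strongly_connected_def by (auto intro!: reachable_mk_symmetricI)
qed

lemma paley_automorphismI:
  fixes g :: "'a::{finite, field} \<Rightarrow> 'a"
  assumes q: "CARD('a) = 4 * k + 1" and "bij g"
    and g: "\<And>x y. (g x - g y) ^ (2 * k) = (x - y) ^ (2 * k)"
  shows "\<exists>f\<in>graph_automorphisms paley_graph. iso_verts f = g"
proof -
  let ?G = "paley_graph :: ('a, 'a \<times> 'a) pre_digraph"
  have qm: "CARD('a) = 2 * (2 * k) + 1" by (simp add: q)
  interpret graph ?G using q by (intro graph_paley_graph) simp
  note arcs = arcs_paley(1)[OF qm]
  \<comment> \<open>Head and tail stay the projections, so that \<open>app_iso\<close> returns the
    very same record.\<close>
  define f where "f = \<lparr>iso_verts = g, iso_arcs = map_prod g g, iso_head = snd, iso_tail = fst\<rparr>"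
  have inj: "inj g" and surj: "surj g" using \<open>bij g\<close> by (auto simp: bij_def)
  have "map_prod g g ` arcs ?G = arcs ?G"
  proof (intro equalityI subsetI)
    fix e assume "e \<in> arcs ?G"
    moreover obtain x y where "e = (g x, g y)" using surj by (metis surj_def surj_pair)
    ultimately show "e \<in> map_prod g g ` arcs ?G" by (force simp: arcs g)
  qed (auto simp: arcs g)
  hence "app_iso f ?G = ?G" using surj by (simp add: app_iso_def f_def)
  moreover have "digraph_isomorphism f"
    unfolding digraph_isomorphism_def
    using inj wf_digraph_axioms by (auto simp: f_def inj_on_def)
  ultimately show ?thesis by (intro bexI[of _ f]) (auto simp: graph_automorphisms_def f_def)
qed

lemma paley_automorphismD:
  fixes f :: "('a::{finite, field}, 'a \<times> 'a, 'a, 'a \<times> 'a) digraph_isomorphism"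
  assumes q: "CARD('a) = 4 * k + 1" and f: "f \<in> graph_automorphisms paley_graph"
  shows "bij (iso_verts f)"
    and "(iso_verts f x - iso_verts f y) ^ (2 * k) = (x - y) ^ (2 * k)"
proof -
  let ?G = "paley_graph :: ('a, 'a \<times> 'a) pre_digraph"
  define m where "m = 2 * k"
  have qm: "CARD('a) = 2 * m + 1" by (simp add: q m_def)
  define g where "g = iso_verts f"
  note arcs = arcs_paley(1)[OF qm]
  have iso: "pre_digraph.digraph_isomorphism ?G f" and app: "app_iso f ?G = ?G"
    using f by (auto simp: graph_automorphisms_def)
  have inj: "inj g" using iso by (simp add: pre_digraph.digraph_isomorphism_def g_def)
  thus "bij (iso_verts f)" by (simp add: bij_def finite_UNIV_inj_surj g_def)
  \<comment> \<open>Equality of the two records fixes head and tail; on arcs,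
    \<open>iso_arcs f\<close> is then determined by \<open>iso_verts f\<close>.\<close>
  have "iso_tail f = fst" "iso_head f = snd" and im: "iso_arcs f ` arcs ?G = arcs ?G"
    using arg_cong[OF app, of tail] arg_cong[OF app, of head] arg_cong[OF app, of arcs] by simp_all
  hence arc: "iso_arcs f (u, v) = (g u, g v)" if "(u, v) \<in> arcs ?G" for u v
    using iso that unfolding pre_digraph.digraph_isomorphism_def
    by (auto simp: g_def prod_eq_iff dest!: bspec[of _ _ "(u, v)"])
  have iff: "(g x - g y) ^ m = 1 \<longleftrightarrow> (x - y) ^ m = 1"
  proof
    assume "(x - y) ^ m = 1"
    hence "(x, y) \<in> arcs ?G" by (simp add: arcs)
    hence "(g x, g y) \<in> arcs ?G" using im arc by (metis imageI)
    thus "(g x - g y) ^ m = 1" by (simp add: arcs)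
  next
    assume "(g x - g y) ^ m = 1"
    hence "(g x, g y) \<in> iso_arcs f ` arcs ?G" unfolding im by (simp add: arcs)
    then obtain u v where "(u, v) \<in> arcs ?G" "(g x, g y) = (g u, g v)" using arc by fastforce
    thus "(x - y) ^ m = 1" using inj by (auto simp: arcs inj_eq)
  qed
  \<comment> \<open>For distinct points both powers are 1 or -1, so preserving adjacency already
    preserves the power.\<close>
  have "(g x - g y) ^ m = (x - y) ^ m"
  proof (cases "x = y")
    case False
    hence "g x - g y \<noteq> 0" "x - y \<noteq> 0" using inj by (auto simp: inj_eq)
    thus ?thesis using power_half_cases[OF qm] iff by metis
  qed simp
  thus "(iso_verts f x - iso_verts f y) ^ (2 * k) = (x - y) ^ (2 * k)" by (simp add: g_def m_def)
qed

lemma bij_affine: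
  fixes a :: "'a::field"
  assumes "a \<noteq> 0"
  shows "bij (\<lambda>x. a * x + b)"
  by (rule bij_betwI[of _ _ _ "\<lambda>y. (y - b) / a"]) (use assms in auto)

lemma distance_transitive_paley:
  assumes q: "CARD('a::{finite, field}) = 4 * k + 1"
  shows "distance_transitive (paley_graph :: ('a, 'a \<times> 'a) pre_digraph)"
  unfolding distance_transitive_def
proof (intro conjI ballI impI)
  let ?G = "paley_graph :: ('a, 'a \<times> 'a) pre_digraph"
  have qm: "CARD('a) = 2 * (2 * k) + 1" by (simp add: q)
  show "Digraph_Component.connected ?G" by (rule connected_paley[OF q])
  fix u1 v1 u2 v2 :: 'a
  assume eq: "graph_dist ?G u1 v1 = graph_dist ?G u2 v2"
  \<comment> \<open>The slope takes \<open>u1 - v1\<close> to \<open>u2 - v2\<close>; when the two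
    points coincide, the value 1 makes the map a translation.\<close>
  define a where "a = (if u1 = v1 then 1 else (u2 - v2) / (u1 - v1))"
  have same: "u1 = v1 \<longleftrightarrow> u2 = v2" "(u1 - v1) ^ (2 * k) = 1 \<longleftrightarrow> (u2 - v2) ^ (2 * k) = 1"
    using eq CARD_field_ge_2[where 'a='a] q
    by (auto simp: graph_dist_paley[OF q] power_0_left split: if_splits)
  hence "(u1 - v1) ^ (2 * k) = (u2 - v2) ^ (2 * k)"
    using power_half_cases[OF qm, of "u1 - v1"] power_half_cases[OF qm, of "u2 - v2"]
    by (cases "u1 = v1") (simp, metis eq_iff_diff_eq_0)
  hence a: "a ^ (2 * k) = 1" using same(1) by (simp add: a_def power_divide)
  have "a \<noteq> 0" using same by (auto simp: a_def)
  define g where "g x = a * x + (v2 - a * v1)" for x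
  have "bij g" unfolding g_def using \<open>a \<noteq> 0\<close> by (rule bij_affine)
  moreover have "(g x - g y) ^ (2 * k) = (x - y) ^ (2 * k)" for x y
  proof -
    have "g x - g y = a * (x - y)" by (simp add: g_def algebra_simps)
    thus ?thesis by (simp add: power_mult_distrib a)
  qed
  ultimately obtain f where f: "f \<in> graph_automorphisms ?G" "iso_verts f = g"
    using paley_automorphismI[OF q] by blast
  have "g u1 = a * (u1 - v1) + v2" by (simp add: g_def algebra_simps)
  hence "g u1 = u2" using same by (auto simp: a_def)
  moreover have "g v1 = v2" by (simp add: g_def)
  ultimately show "\<exists>f\<in>graph_automorphisms ?G. iso_verts f u1 = u2 \<and> iso_verts f v1 = v2"
    using f by auto
qed

text \<open>Non-adjacency of distinct ends becomes the value -1, which also excludes equal ends.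
  Differences may be oriented along the path because the exponent is even.\<close>

lemma geodesic_paley_2_iff:
  assumes q: "CARD('a::{finite, field}) = 4 * k + 1"
  shows "geodesic (paley_graph :: ('a, 'a \<times> 'a) pre_digraph) 2 p \<longleftrightarrow>
    (\<exists>u w v. p = [u, w, v] \<and> (w - u) ^ (2 * k) = 1 \<and> (v - w) ^ (2 * k) = 1 \<and> (v - u) ^ (2 * k) = -1)"
  (is "?L \<longleftrightarrow> ?R")
proof -
  have qm: "CARD('a) = 2 * (2 * k) + 1" by (simp add: q)
  have k: "k > 0" using q CARD_field_ge_2[where 'a='a] by simp
  note ends = arcs_paley(2)[OF qm]
  note neq = one_neq_minus_one[OF qm]
  have dist: "graph_dist paley_graph u (v :: 'a) = ereal (real 2) \<longleftrightarrow> (v - u) ^ (2 * k) = -1" for u v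
    using power_half_cases[OF qm, of "v - u"] neq k
    by (auto simp: graph_dist_paley[OF q] even_power_minus_commute[of u] power_0_left zero_ereal_def one_ereal_def)
  have comm: "(u - w) ^ (2 * k) = (w - u) ^ (2 * k)" for u w :: 'a by (rule even_power_minus_commute)
  have len: "vwalk_length p = 2 \<longleftrightarrow> (\<exists>u w v. p = [u, w, v])"
    by (auto simp: length_Suc_conv numeral_eq_Suc diff_Suc split: nat.splits)
  show ?thesis
  proof
    assume ?L
    then obtain u w v where p: "p = [u, w, v]" using len by (auto simp: geodesic_def simp del: vwalk_length_simp)
    show ?R using \<open>?L\<close> unfolding geodesic_def vpath_def vwalk_def p
      by (auto simp: ends dist[simplified] comm[of u w] comm[of w v])
  next
    assume ?R
    then obtain u w v where p: "p = [u, w, v]"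
      "(w - u) ^ (2 * k) = 1" "(v - w) ^ (2 * k) = 1" "(v - u) ^ (2 * k) = -1" by blast
    moreover have "distinct p" using p k neq by (auto simp: power_0_left)
    ultimately show ?L unfolding geodesic_def vpath_def vwalk_def
      by (auto simp: ends dist[simplified] comm[of u w] comm[of w v])
  qed
qed

lemma graph_diameter_paley:
  assumes q: "CARD('a::{finite, field}) = 4 * k + 1"
  shows "graph_diameter (paley_graph :: ('a, 'a \<times> 'a) pre_digraph) = 2"
proof (rule antisym)
  have qm: "CARD('a) = 2 * (2 * k) + 1" by (simp add: q)
  have k: "k > 0" using q CARD_field_ge_2[where 'a='a] by simp
  show "graph_diameter (paley_graph :: ('a, 'a \<times> 'a) pre_digraph) \<le> 2"
    unfolding graph_diameter_def by (intro SUP_least) (simp add: graph_dist_paley[OF q])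
  have "{n :: 'a. n ^ (2 * k) = -1 \<and> (n - 1) ^ (2 * k) = 1} \<noteq> {}"
    using card_half_powers[OF q] k by (metis card.empty less_irrefl)
  then obtain n :: 'a where "n ^ (2 * k) = -1" by blast
  hence "graph_dist paley_graph n 0 = 2"
    using one_neq_minus_one[OF qm] k by (auto simp: graph_dist_paley[OF q] power_0_left)
  thus "2 \<le> graph_diameter (paley_graph :: ('a, 'a \<times> 'a) pre_digraph)"
    unfolding graph_diameter_def by (intro SUP_upper2[of n] SUP_upper2[of 0]) auto
qed

section \<open>Geodesic transitivity\<close>

lemma geodesic_transitive_paley_imp:
  assumes q: "CARD('a::{finite, field}) = 4 * k + 1" and pp: "primepow (CARD('a))"
    and gt: "geodesic_transitive (paley_graph :: ('a, 'a \<times> 'a) pre_digraph)"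
  shows "CARD('a) = 5 \<or> CARD('a) = 9"
proof -
  let ?G = "paley_graph :: ('a, 'a \<times> 'a) pre_digraph"
  have qm: "CARD('a) = 2 * (2 * k) + 1" by (simp add: q)
  have k: "k > 0" using q CARD_field_ge_2[where 'a='a] by simp
  obtain r where r: "r > 0" "CARD('a) = CHAR('a) ^ r" and p: "prime CHAR('a)"
    using finite_field_prime_power[OF pp] by blast
  define N where "N = {n :: 'a. n ^ (2 * k) = -1 \<and> (n - 1) ^ (2 * k) = 1}"
  have N: "card N = k" unfolding N_def by (rule card_half_powers[OF q])
  hence "N \<noteq> {}" using k by auto
  then obtain n0 where n0: "n0 \<in> N" by blast
  have "N \<subseteq> (\<lambda>s. n0 ^ (CHAR('a) ^ s)) ` {..<r}"
  proof
    fix n assume n: "n \<in> N"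
    have "geodesic ?G 2 [0, 1, n]" "geodesic ?G 2 [0, 1, n0]"
      using n n0 by (auto simp: geodesic_paley_2_iff[OF q] N_def)
    moreover have "1 \<le> (2::nat) \<and> ereal (real 2) \<le> graph_diameter ?G"
      by (simp add: graph_diameter_paley[OF q])
    ultimately have "\<exists>f\<in>graph_automorphisms ?G. map (iso_verts f) [0, 1, n] = [0, 1, n0]"
      using gt unfolding geodesic_transitive_def by metis
    then obtain f where f: "f \<in> graph_automorphisms ?G" "map (iso_verts f) [0, 1, n] = [0, 1, n0]"
      by (elim bexE)
    interpret quadratic_character_map "iso_verts f" "2 * k"
      using qm paley_automorphismD[OF q f(1)] f(2) by unfold_locales auto
    obtain s where s: "CHAR('a) ^ s \<le> 2 * k" "\<And>x. iso_verts f x ^ (CHAR('a) ^ s) = x"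
      using power_CHAR_identity by blast
    have "CHAR('a) ^ s < CHAR('a) ^ r" using s(1) r(2) q by linarith
    hence "s < r" by (rule power_less_imp_less_exp[OF prime_gt_1_nat[OF p]])
    moreover have "n = n0 ^ (CHAR('a) ^ s)" using s(2)[of n] f(2) by simp
    ultimately show "n \<in> (\<lambda>s. n0 ^ (CHAR('a) ^ s)) ` {..<r}" by blast
  qed
  hence "card N \<le> r" using surj_card_le[of "{..<r}" N] by simp
  thus ?thesis using prime_power_small[OF p r(1), of k] r(2) q N by simp
qed

text \<open>An affine map whose slope is a square normalises a 2-geodesic to
  \<open>[0, 1, n]\<close>, so only the stabiliser of 0 and 1 has to be examined. The 1-geodesics
  are covered by distance transitivity.\<close>

lemma geodesic_transitive_paleyI:
  assumes q: "CARD('a::{finite, field}) = 4 * k + 1"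
    and stab: "\<And>n n' :: 'a. n ^ (2 * k) = -1 \<Longrightarrow> (n - 1) ^ (2 * k) = 1 \<Longrightarrow>
      n' ^ (2 * k) = -1 \<Longrightarrow> (n' - 1) ^ (2 * k) = 1 \<Longrightarrow>
      \<exists>\<sigma>. bij \<sigma> \<and> (\<forall>x y. (\<sigma> x - \<sigma> y) ^ (2 * k) = (x - y) ^ (2 * k)) \<and>
        \<sigma> 0 = 0 \<and> \<sigma> 1 = 1 \<and> \<sigma> n = n'"
  shows "geodesic_transitive (paley_graph :: ('a, 'a \<times> 'a) pre_digraph)"
  unfolding geodesic_transitive_def
proof (intro conjI allI impI)
  let ?G = "paley_graph :: ('a, 'a \<times> 'a) pre_digraph"
  have k: "k > 0" using q CARD_field_ge_2[where 'a='a] by simp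
  show "Digraph_Component.connected ?G" by (rule connected_paley[OF q])
  fix i p p'
  assume i: "1 \<le> i \<and> ereal (real i) \<le> graph_diameter ?G" and geo: "geodesic ?G i p \<and> geodesic ?G i p'"
  have "i \<le> 2" using i by (simp add: graph_diameter_paley[OF q])
  then consider "i = 1" | "i = 2" using i by linarith
  thus "\<exists>f\<in>graph_automorphisms ?G. map (iso_verts f) p = p'"
  proof cases
    case 1
    have "\<exists>u v. p = [u, v] \<and> graph_dist ?G u v = 1" if "geodesic ?G 1 p" for p
      using that by (cases p; cases "tl p") (auto simp: geodesic_def one_ereal_def)
    then obtain u v u' v' where "p = [u, v]" "graph_dist ?G u v = 1"
      "p' = [u', v']" "graph_dist ?G u' v' = 1" using geo 1 by metis
    thus ?thesis using distance_transitive_paley[OF q] by (auto simp: distance_transitive_def)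
  next
    case 2
    obtain u w v where p: "p = [u, w, v]"
      "(w - u) ^ (2 * k) = 1" "(v - w) ^ (2 * k) = 1" "(v - u) ^ (2 * k) = -1"
      using geo 2 geodesic_paley_2_iff[OF q] by metis
    obtain u' w' v' where p': "p' = [u', w', v']"
      "(w' - u') ^ (2 * k) = 1" "(v' - w') ^ (2 * k) = 1" "(v' - u') ^ (2 * k) = -1"
      using geo 2 geodesic_paley_2_iff[OF q] by metis
    define a a' where "a = w - u" and "a' = w' - u'"
    have nz: "a \<noteq> 0" "a' \<noteq> 0" using p p' k by (auto simp: a_def a'_def power_0_left)
    define n n' where "n = (v - u) / a" and "n' = (v' - u') / a'"
    have "n - 1 = (v - w) / a" "n' - 1 = (v' - w') / a'"
      using nz by (auto simp: n_def n'_def field_simps) (auto simp: a_def a'_def)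
    hence "n ^ (2 * k) = -1" "(n - 1) ^ (2 * k) = 1" "n' ^ (2 * k) = -1" "(n' - 1) ^ (2 * k) = 1"
      using p p' by (auto simp: power_divide n_def n'_def a_def a'_def)
    then obtain \<sigma> where \<sigma>: "bij \<sigma>" "\<And>x y. (\<sigma> x - \<sigma> y) ^ (2 * k) = (x - y) ^ (2 * k)"
      "\<sigma> 0 = 0" "\<sigma> 1 = 1" "\<sigma> n = n'" using stab by blast
    \<comment> \<open>Normalise the first geodesic, apply \<open>\<sigma>\<close>, and undo the
      normalisation of the second.\<close>
    define g where "g x = a' * \<sigma> ((x - u) / a) + u'" for x
    have "bij g"
    proof -
      have "g = (\<lambda>x. a' * x + u') \<circ> (\<sigma> \<circ> (\<lambda>x. inverse a * x + (- u / a)))"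
        by (auto simp: fun_eq_iff g_def divide_inverse algebra_simps)
      thus ?thesis using nz by (simp only:) (intro bij_comp bij_affine \<sigma>(1), simp_all)
    qed
    moreover have "(g x - g y) ^ (2 * k) = (x - y) ^ (2 * k)" for x y
    proof -
      have "g x - g y = a' * (\<sigma> ((x - u) / a) - \<sigma> ((y - u) / a))" by (simp add: g_def algebra_simps)
      also have "\<dots> ^ (2 * k) = ((x - u) / a - (y - u) / a) ^ (2 * k)"
        using p' by (simp add: power_mult_distrib \<sigma>(2) a'_def)
      also have "(x - u) / a - (y - u) / a = (x - y) / a" by (simp add: diff_divide_distrib)
      finally show ?thesis using p by (simp add: power_divide a_def)
    qed
    ultimately obtain f where f: "f \<in> graph_automorphisms ?G" "iso_verts f = g"
      using paley_automorphismI[OF q] by blast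
    have "g u = u'" "g w = w'" by (simp_all add: g_def \<sigma> a_def[symmetric] nz) (simp add: a'_def)
    moreover have "g v = v'" using nz by (simp add: g_def \<sigma>(5) flip: n_def) (simp add: n'_def)
    ultimately show ?thesis using f by (auto simp: p p')
  qed
qed

lemma geodesic_transitive_paley_5:
  assumes "CARD('a::{finite, field}) = 5"
  shows "geodesic_transitive (paley_graph :: ('a, 'a \<times> 'a) pre_digraph)"
proof (rule geodesic_transitive_paleyI[where k = 1])
  have neq: "(1 :: 'a) \<noteq> -1" by (rule one_neq_minus_one[where m = 2]) (simp add: assms)
  hence two: "(2 :: 'a) \<noteq> 0" by (metis add_eq_0_iff one_add_one)
  fix n n' :: 'a
  assume "n ^ (2 * 1) = -1" "(n - 1) ^ (2 * 1) = 1" "n' ^ (2 * 1) = -1" "(n' - 1) ^ (2 * 1) = 1"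
  \<comment> \<open>Inserting the first equation into the expanded second one leaves a linear
    equation for \<open>n\<close>.\<close>
  hence "- (2 * n) = 1" "- (2 * n') = 1" by (simp_all add: power2_eq_square algebra_simps)
  hence "n = n'" using two by (metis mult_cancel_left neg_equal_iff_equal)
  thus "\<exists>\<sigma>. bij \<sigma> \<and> (\<forall>x y. (\<sigma> x - \<sigma> y) ^ (2 * 1) = (x - y) ^ (2 * 1)) \<and> \<sigma> 0 = 0 \<and> \<sigma> 1 = 1 \<and> \<sigma> n = n'"
    by (intro exI[of _ "\<lambda>x. x"]) (simp add: bij_id[unfolded id_def])
qed (simp add: assms)

lemma geodesic_transitive_paley_9:
  assumes q: "CARD('a::{finite, field}) = 9"
  shows "geodesic_transitive (paley_graph :: ('a, 'a \<times> 'a) pre_digraph)"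
proof (rule geodesic_transitive_paleyI[where k = 2])
  have "prime CHAR('a)" by (rule prime_CHAR_semidom) (simp add: finite_imp_CHAR_pos)
  moreover have "CHAR('a) dvd 3 ^ 2" using CHAR_dvd_CARD[where 'a='a] q by simp
  ultimately have char: "CHAR('a) = 3"
    using prime_dvd_power[of "CHAR('a)" 3 2] primes_dvd_imp_eq[of "CHAR('a)" 3] by simp
  have three: "(3 :: 'a) = 0" using of_nat_CHAR[where 'a='a] by (simp add: char)
  have qm: "CARD('a) = 2 * 4 + 1" by (simp add: q)
  have cube_diff: "(x - y) ^ 3 = x ^ 3 - y ^ 3" for x y :: 'a
  proof -
    have "(x - y + y) ^ 3 = (x - y) ^ 3 + y ^ 3"
      by (rule freshmans_dream) (simp_all add: char)
    thus ?thesis by (simp add: algebra_simps)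
  qed
  \<comment> \<open>The conditions make \<open>n\<close> a root of \<open>X\<^sup>2 + X + 2\<close>,
    whose roots add up to -1; the other root \<open>-1 - n\<close> is the Frobenius image
    \<open>n ^ 3\<close>.\<close>
  have root: "n\<^sup>2 + n + 2 = 0 \<and> n ^ 3 = -1 - n" if "n ^ 4 = -1" "(n - 1) ^ 4 = 1" for n :: 'a
  proof -
    have "(n - 1) ^ 4 = (n ^ 3 - 1) * (n - 1)" using cube_diff[of n 1] by (simp add: eval_nat_numeral)
    also have "\<dots> = n ^ 4 - n ^ 3 - n + 1" by (simp add: eval_nat_numeral algebra_simps)
    finally have eq: "n ^ 4 - n ^ 3 - n + 1 = 1" using that(2) by simp
    have "n ^ 3 = - (n ^ 4 - n ^ 3 - n + 1) + n ^ 4 - n + 1" by simp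
    also have "\<dots> = -1 - n" unfolding eq by (simp add: that(1))
    finally have *: "n ^ 3 = -1 - n" .
    have "(n - 1) * (n\<^sup>2 + n + 2) = n ^ 3 + n - 2" by (simp add: eval_nat_numeral algebra_simps)
    also have "\<dots> = -3" by (simp add: *)
    finally have "(n - 1) * (n\<^sup>2 + n + 2) = 0" by (simp add: three)
    moreover have "n \<noteq> 1" using that(2) by auto
    ultimately show ?thesis using * by simp
  qed
  fix n n' :: 'a
  assume "n ^ (2 * 2) = -1" "(n - 1) ^ (2 * 2) = 1" "n' ^ (2 * 2) = -1" "(n' - 1) ^ (2 * 2) = 1"
  hence r: "n\<^sup>2 + n + 2 = 0" "n ^ 3 = -1 - n" "n'\<^sup>2 + n' + 2 = 0" using root[of n] root[of n'] by simp_all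
  have "(n - n') * (n + n' + 1) = (n\<^sup>2 + n + 2) - (n'\<^sup>2 + n' + 2)"
    by (simp add: power2_eq_square algebra_simps)
  hence "n' = n \<or> n + n' + 1 = 0" using r by auto
  moreover have "n' = (n + n' + 1) - 1 - n" by simp
  ultimately have "n' = n \<or> n' = -1 - n" by (metis diff_0)
  hence cases: "n' = n \<or> n' = n ^ 3" using r(2) by simp
  show "\<exists>\<sigma>. bij \<sigma> \<and> (\<forall>x y. (\<sigma> x - \<sigma> y) ^ (2 * 2) = (x - y) ^ (2 * 2)) \<and> \<sigma> 0 = 0 \<and> \<sigma> 1 = 1 \<and> \<sigma> n = n'"
  proof (cases "n' = n")
    case True
    thus ?thesis by (intro exI[of _ "\<lambda>x. x"]) (simp add: bij_id[unfolded id_def])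
  next
    case False
    have "inj (\<lambda>x::'a. x ^ 3)"
    proof
      fix x y :: 'a assume "x ^ 3 = y ^ 3"
      hence "(x - y) ^ 3 = 0" by (simp add: cube_diff)
      thus "x = y" by simp
    qed
    hence "bij (\<lambda>x::'a. x ^ 3)" by (simp add: bij_def finite_UNIV_inj_surj)
    moreover have "(x ^ 3 - y ^ 3) ^ 4 = (x - y) ^ 4" for x y :: 'a
    proof -
      have "(x ^ 3 - y ^ 3) ^ 4 = ((x - y) ^ 4) ^ 3" by (simp flip: cube_diff power_mult)
      \<comment> \<open>Fourth powers are 0, 1 or -1, all fixed by cubing.\<close>
      also have "\<dots> = (x - y) ^ 4" using power_half_cases[OF qm, of "x - y"]
        by (cases "x = y") (auto simp del: power_mult_numeral)
      finally show ?thesis .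
    qed
    ultimately show ?thesis using cases False by (intro exI[of _ "\<lambda>x. x ^ 3"]) simp
  qed
qed (simp add: q)

theorem theorem1p3:
  fixes q :: nat
  assumes "primepow q" and "[q = 1] (mod 4)" and "CARD('a::{finite, field}) = q"
  shows "distance_transitive (paley_graph :: ('a, 'a \<times> 'a) pre_digraph) \<and>
    (geodesic_transitive (paley_graph :: ('a, 'a \<times> 'a) pre_digraph) \<longleftrightarrow> q = 5 \<or> q = 9)"
proof -
  have "q mod 4 = 1" using assms(2) by (simp add: cong_def)
  hence q: "CARD('a) = 4 * (q div 4) + 1" using assms(3) by presburger
  show ?thesis
    using distance_transitive_paley[OF q] geodesic_transitive_paley_imp[OF q]
      geodesic_transitive_paley_5[where 'a='a] geodesic_transitive_paley_9[where 'a='a] assms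
    by blast
qed

end
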